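(* Let $U\in\mathbb{R}^{n\times n}$ be orthogonal and let $\Sigma^{-1}$ be a diagonal matrix with positive diagonal entries $1/\sigma_{ii}^2$. Let $\mathcal{K}_{\mathcal{E}}=\{\zeta\in\mathbb{R}^n:\zeta^TU^T\Sigma^{-1}U\zeta\le 1\}$, let $\zeta$ be uniformly distributed on $\mathcal{K}_{\mathcal{E}}$, and let $\mathcal{X}\subset\mathbb{R}^n$ be closed, convex and bounded. Let $\mathcal{K}_2=\{\eta\in\mathbb{R}^n:\|\eta\|_2^2\le 1\}$ and $\eta=\Sigma^{-1/2}U\zeta$. Then $\mathbf{x}$ is a solution of $$\max_{\mathbf{x}\in\mathcal{X}}\ f(\mathbf{x})=\mathbb{P}\{\zeta:\zeta\in\mathcal{K}_{\mathcal{E}},\ |\zeta^T\mathbf{x}|\le 1\}$$ if and only if $\mathbf{x}$ is a solution of $$\max_{\mathbf{x}\in\mathcal{X}}\ g(\mathbf{x})=\mathbb{P}\{\eta:\eta\in\mathcal{K}_2,\ |\eta^T\Sigma^{1/2}U\mathbf{x}|\le 1\}.$$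
   Context: A solution of a maximization problem means a global maximizer. The random vector $\eta=\Sigma^{-1/2}U\zeta$ (equivalently $\zeta=U^T\Sigma^{1/2}\eta$) takes values in $\mathcal{K}_2$. *)

theory Defs
  imports "HOL-Probability.Probability"
begin

definition diag_mat :: "('n \<Rightarrow> real) \<Rightarrow> real ^ 'n ^ 'n" where
  "diag_mat d = (\<chi> i j. if i = j then d i else 0)"

(* The principal square root: the unique symmetric positive semidefinite root, which exists
   for symmetric positive semidefinite A.  For a diagonal matrix it consists of the
   nonnegative square roots of the diagonal entries, see matrix_sqrt_diag_mat. *)
definition matrix_sqrt :: "real ^ 'n ^ 'n \<Rightarrow> real ^ 'n ^ 'n" where
  "matrix_sqrt A = (THE B. transpose B = B \<and> (\<forall>v. 0 \<le> v \<bullet> (B *v v)) \<and> B ** B = A)"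

lemma diag_mat_mult_vec: "diag_mat d *v v = (\<chi> i. d i * v $ i)"
  by (simp add: diag_mat_def matrix_vector_mult_def vec_eq_iff if_distrib if_distribR cong: if_cong)

lemma diag_mat_mult: "diag_mat c ** diag_mat d = diag_mat (\<lambda>i. c i * d i)"
  by (simp add: matrix_eq diag_mat_mult_vec mult.assoc flip: matrix_vector_mul_assoc)

lemma matrix_sqrt_diag_mat:
  fixes d :: "'n::finite \<Rightarrow> real"
  assumes pos: "\<And>i. 0 < d i"
  shows "matrix_sqrt (diag_mat d) = diag_mat (\<lambda>i. sqrt (d i))"
  unfolding matrix_sqrt_def
proof (rule the_equality, intro conjI allI)
  show "transpose (diag_mat (\<lambda>i. sqrt (d i))) = diag_mat (\<lambda>i. sqrt (d i))"
    by (simp add: transpose_def diag_mat_def vec_eq_iff)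
  show "0 \<le> v \<bullet> (diag_mat (\<lambda>i. sqrt (d i)) *v v)" for v
  proof -
    have "0 \<le> v $ i * (sqrt (d i) * v $ i)" for i
    proof -
      have "v $ i * (sqrt (d i) * v $ i) = sqrt (d i) * (v $ i)\<^sup>2"
        by (simp add: power2_eq_square)
      moreover have "0 \<le> sqrt (d i) * (v $ i)\<^sup>2" using less_imp_le[OF pos[of i]] by simp
      ultimately show ?thesis by (rule ssubst)
    qed
    then show ?thesis by (simp add: inner_vec_def diag_mat_mult_vec sum_nonneg)
  qed
  show "diag_mat (\<lambda>i. sqrt (d i)) ** diag_mat (\<lambda>i. sqrt (d i)) = diag_mat d"
    using less_imp_le[OF pos] by (simp add: diag_mat_mult)
next
  fix B :: "real ^ 'n ^ 'n"
  assume B: "transpose B = B \<and> (\<forall>v. 0 \<le> v \<bullet> (B *v v)) \<and> B ** B = diag_mat d"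
  have col: "B *v axis i 1 = sqrt (d i) *\<^sub>R axis i 1" for i
  proof -
    define e :: "real ^ 'n" where "e = axis i 1"
    define v where "v = B *v e - sqrt (d i) *\<^sub>R e"
    have "B *v (B *v e) = d i *\<^sub>R e"
    proof -
      have "B *v (B *v e) = diag_mat d *v e"
        using B by (simp add: matrix_vector_mul_assoc)
      also have "\<dots> = d i *\<^sub>R e"
        by (simp add: diag_mat_mult_vec vec_eq_iff e_def axis_def)
      finally show ?thesis .
    qed
    then have "B *v v = d i *\<^sub>R e - sqrt (d i) *\<^sub>R (B *v e)"
      by (simp add: v_def matrix_vector_mult_diff_distrib matrix_vector_mult_scaleR)
    also have "\<dots> = - sqrt (d i) *\<^sub>R v"
      using less_imp_le[OF pos[of i]] by (simp add: v_def algebra_simps)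
    finally have "v \<bullet> (B *v v) = - (sqrt (d i) * (v \<bullet> v))" by simp
    moreover have "0 \<le> v \<bullet> (B *v v)" using B by blast
    ultimately have "sqrt (d i) * (v \<bullet> v) \<le> 0" by simp
    then have "v \<bullet> v \<le> 0" using pos[of i] by (simp add: mult_le_0_iff)
    then have "v = 0" by (metis inner_gt_zero_iff not_le)
    then show ?thesis by (simp add: v_def e_def)
  qed
  show "B = diag_mat (\<lambda>i. sqrt (d i))"
  proof -
    have "B $ k $ i = (sqrt (d i) *\<^sub>R axis i 1 :: real ^ 'n) $ k" for k i
      unfolding col[symmetric] by (simp add: matrix_vector_mult_basis column_def)
    then show ?thesis by (auto simp: vec_eq_iff diag_mat_def axis_def)
  qed
qed

end

theory Submission
  imports Defs
begin

text \<open>In fact \<open>f = g\<close>: the two events coincide pointwise, since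
  \<open>\<Sigma>\<^sup>-\<^sup>1 = \<Sigma>\<^sup>-\<^sup>1\<^sup>/\<^sup>2 \<Sigma>\<^sup>-\<^sup>1\<^sup>/\<^sup>2\<close> gives \<open>\<parallel>\<eta>\<parallel>\<^sup>2 = \<zeta>\<^sup>T U\<^sup>T \<Sigma>\<^sup>-\<^sup>1 U \<zeta>\<close>, and the factors
  \<open>\<Sigma>\<^sup>-\<^sup>1\<^sup>/\<^sup>2\<close>, \<open>\<Sigma>\<^sup>1\<^sup>/\<^sup>2\<close> and \<open>U\<^sup>T\<close>, \<open>U\<close> cancel in \<open>\<eta>\<^sup>T \<Sigma>\<^sup>1\<^sup>/\<^sup>2 U x = \<zeta>\<^sup>T x\<close>.\<close>

lemma transpose_diag_mat: "transpose (diag_mat d) = diag_mat d"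
  by (simp add: transpose_def diag_mat_def vec_eq_iff)

lemma diag_mat_one: "diag_mat (\<lambda>i. 1) = mat 1"
  by (simp add: diag_mat_def mat_def)

lemma matrix_inv_left:
  fixes A :: "real ^ 'n ^ 'm"
  assumes "invertible A"
  shows "matrix_inv A ** A = mat 1"
  using someI_ex[OF assms[unfolded invertible_def]] by (simp add: matrix_inv_def)

text \<open>A right inverse of a square matrix is two-sided, so \<open>A\<close> is invertible and
  multiplying the assumption by \<open>matrix_inv A\<close> on the left isolates
  \<open>B\<close>.\<close>

lemma matrix_inv_eqI:
  fixes A B :: "real ^ 'n ^ 'n"
  assumes "A ** B = mat 1"
  shows "matrix_inv A = B"
proof -
  have "invertible A"
    using assms invertible_right_inverse by blast
  then have "matrix_inv A ** (A ** B) = B"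
    by (simp add: matrix_mul_assoc matrix_inv_left)
  then show ?thesis
    by (simp add: assms)
qed

lemma matrix_inv_diag_mat:
  fixes d :: "'n::finite \<Rightarrow> real"
  assumes "\<And>i. d i \<noteq> 0"
  shows "matrix_inv (diag_mat d) = diag_mat (\<lambda>i. 1 / d i)"
  by (rule matrix_inv_eqI) (simp add: diag_mat_mult assms diag_mat_one)

lemma matrix_inv_matrix_inv:
  fixes A :: "real ^ 'n ^ 'n"
  assumes "invertible A"
  shows "matrix_inv (matrix_inv A) = A"
  by (rule matrix_inv_eqI) (rule matrix_inv_left[OF assms])

text \<open>Adjointness gathers both matrices on one side, which reduces each of the two event
  conditions to a matrix product.\<close>

lemma inner_matrix_vector_mult:
  fixes A :: "real ^ 'n ^ 'm" and B :: "real ^ 'k ^ 'm"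
  shows "(A *v x) \<bullet> (B *v y) = x \<bullet> ((transpose A ** B) *v y)"
  by (metis dot_lmul_matrix inner_commute matrix_vector_mul_assoc transpose_matrix_vector)

theorem lemma6:
  fixes U Sigma :: "real ^ 'n ^ 'n"
    and sigma :: "'n \<Rightarrow> real"
    and M :: "'w measure"
    and zeta eta :: "'w \<Rightarrow> real ^ 'n"
    and X KE K2 :: "(real ^ 'n) set"
    and f g :: "real ^ 'n \<Rightarrow> real"
    and x :: "real ^ 'n"
  assumes "orthogonal_matrix U"
    and "invertible Sigma"
    and "matrix_inv Sigma = diag_mat (\<lambda>i. 1 / (sigma i)\<^sup>2)"
    and "\<And>i. 1 / (sigma i)\<^sup>2 > 0"
    and "KE = {z. z \<bullet> ((transpose U ** matrix_inv Sigma ** U) *v z) \<le> 1}"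
    and "prob_space M"
    and "zeta \<in> borel_measurable M"
    and "distr M borel zeta = uniform_measure lborel KE"
    and "closed X" and "convex X" and "bounded X"
    and "K2 = {y. (norm y)\<^sup>2 \<le> 1}"
    and "eta = (\<lambda>\<omega>. (matrix_inv (matrix_sqrt Sigma) ** U) *v zeta \<omega>)"
    and "f = (\<lambda>x. \<P>(\<omega> in M. zeta \<omega> \<in> KE \<and> \<bar>zeta \<omega> \<bullet> x\<bar> \<le> 1))"
    and "g = (\<lambda>x. \<P>(\<omega> in M. eta \<omega> \<in> K2 \<and> \<bar>eta \<omega> \<bullet> ((matrix_sqrt Sigma ** U) *v x)\<bar> \<le> 1))"
  shows "is_arg_max f (\<lambda>x. x \<in> X) x \<longleftrightarrow> is_arg_max g (\<lambda>x. x \<in> X) x"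
proof -
  \<comment> \<open>The sign of \<open>sigma i\<close> is not fixed, while a principal root has
    nonnegative diagonal entries; hence the absolute values.\<close>
  define R :: "real ^ 'n ^ 'n" where "R = diag_mat (\<lambda>i. \<bar>sigma i\<bar>)"
  define S :: "real ^ 'n ^ 'n" where "S = diag_mat (\<lambda>i. 1 / \<bar>sigma i\<bar>)"
  \<comment> \<open>Since \<open>1 / 0 = 0\<close>, positivity of the reciprocal excludes
    \<open>sigma i = 0\<close>.\<close>
  have nz: "sigma i \<noteq> 0" for i
    using assms(4)[of i] by auto
  \<comment> \<open>\<open>Sigma\<close> is given through its inverse; inverting once more recovers
    its entries.\<close>
  have Sigma: "Sigma = diag_mat (\<lambda>i. (sigma i)\<^sup>2)"
    using matrix_inv_matrix_inv[OF assms(2)] by (simp add: assms(3) matrix_inv_diag_mat nz)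
  have root: "matrix_sqrt Sigma = R"
    unfolding Sigma R_def by (subst matrix_sqrt_diag_mat) (simp_all add: nz)
  have inv_root: "matrix_inv (matrix_sqrt Sigma) = S"
    unfolding root unfolding R_def S_def by (rule matrix_inv_diag_mat) (simp add: nz)
  have tS: "transpose S = S"
    by (simp add: S_def transpose_diag_mat)
  have SS: "S ** S = matrix_inv Sigma"
    by (simp add: assms(3) S_def diag_mat_mult power2_eq_square)
  have SR: "S ** R = mat 1"
    by (simp add: S_def R_def diag_mat_mult nz diag_mat_one)
  have UU: "transpose U ** U = mat 1"
    using assms(1) by (simp add: orthogonal_matrix_def)
  \<comment> \<open>The squared norm is an inner product of a vector with itself, so it becomes the
    quadratic form of the product below.\<close>
  have K: "(S ** U) *v z \<in> K2 \<longleftrightarrow> z \<in> KE" for z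
  proof -
    have "transpose (S ** U) ** (S ** U) = transpose U ** (S ** S) ** U"
      by (simp add: matrix_transpose_mul tS matrix_mul_assoc)
    then show ?thesis
      by (simp add: assms(5,12) power2_norm_eq_inner inner_matrix_vector_mult SS)
  qed
  have inner: "((S ** U) *v z) \<bullet> ((R ** U) *v y) = z \<bullet> y" for y z
  proof -
    have "transpose (S ** U) ** (R ** U) = transpose U ** (S ** R) ** U"
      by (simp add: matrix_transpose_mul tS matrix_mul_assoc)
    then show ?thesis
      by (simp add: inner_matrix_vector_mult SR UU)
  qed
  have "f = g"
    unfolding assms(13,14,15) inv_root unfolding root by (simp add: K inner)
  then show ?thesis
    by simp
qed

end
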